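(* Let $(X, \mu, T)$ be an ergodic $\mathbb{Q}$-system. Then for any nonconstant polynomial $P(x) \in \mathbb{Q}[x]$ and any $f \in L^2(\mu)$, \[ \text{UC-}\lim_{q \in \mathbb{Q}} T^{P(q)} f = \int_X f\, d\mu, \] where the limit is taken in $L^2(\mu)$.
   Context: A $\mathbb{Q}$-system $(X,\mu,T)$: $X$ compact metric, $T$ an action of $(\mathbb{Q},+)$ by homeomorphisms, $\mu$ a $T$-invariant Borel probability measure; ergodic means invariant sets are null or conull. $T^qf=f\circ T^q$. For $v:\mathbb{Q}\to\mathcal{H}$ with values in a topological vector space, $\text{UC-}\lim_{q\in\mathbb{Q}}v(q)=L$ means $\lim_{N}\frac{1}{|\Phi_N|}\sum_{q\in\Phi_N}v(q)=L$ for every Følner sequence $\Phi$ in $\mathbb{Q}$ (a sequence of finite nonempty sets with $|(\Phi_N+x)\triangle\Phi_N|/|\Phi_N|\to0$ for all $x$). *)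

theory Defs
  imports "HOL-Probability.Probability" "HOL-Computational_Algebra.Polynomial"
begin

text \<open>The compact metric space \<open>X\<close> is a compact subset of an arbitrary metric space, and
  \<open>T q\<close> is only constrained on \<open>X\<close>.\<close>

locale Q_system = prob_space M
  for X :: "'a :: metric_space set" and M :: "'a measure" and T :: "rat \<Rightarrow> 'a \<Rightarrow> 'a" +
  assumes compact_X: "compact X"
    and borel_M: "sets M = sets (restrict_space borel X)"
    and homeo_T: "\<And>q. \<exists>g. homeomorphism X X (T q) g"
    and action_zero: "\<And>x. x \<in> X \<Longrightarrow> T 0 x = x"
    and action_add: "\<And>p q x. x \<in> X \<Longrightarrow> T (p + q) x = T p (T q x)"
    and invariant: "\<And>q A. A \<in> sets M \<Longrightarrow> emeasure M (T q -` A \<inter> X) = emeasure M A"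

locale ergodic_Q_system = Q_system +
  assumes ergodic: "\<And>A. A \<in> sets M \<Longrightarrow> (\<And>q. T q -` A \<inter> X = A) \<Longrightarrow>
    emeasure M A = 0 \<or> emeasure M (X - A) = 0"

definition Folner :: "(nat \<Rightarrow> rat set) \<Rightarrow> bool" where
  "Folner \<Phi> \<longleftrightarrow> (\<forall>N. finite (\<Phi> N) \<and> \<Phi> N \<noteq> {}) \<and>
     (\<forall>x. (\<lambda>N. real (card (sym_diff ((\<lambda>q. q + x) ` \<Phi> N) (\<Phi> N)))
            / real (card (\<Phi> N))) \<longlonglongrightarrow> 0)"

text \<open>Elements of \<open>L\<^sup>2\<close> are represented by functions rather than by almost-everywhere classes.\<close>

definition L2 :: "'a measure \<Rightarrow> ('a \<Rightarrow> complex) set" where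
  "L2 M = {f. f \<in> borel_measurable M \<and> integrable M (\<lambda>x. (cmod (f x))\<^sup>2)}"

definition L2_norm :: "'a measure \<Rightarrow> ('a \<Rightarrow> complex) \<Rightarrow> real" where
  "L2_norm M f = sqrt (\<integral>x. (cmod (f x))\<^sup>2 \<partial>M)"

text \<open>Membership in \<open>L2\<close> is required explicitly because the Bochner integral of a
  non-integrable function is \<open>0\<close>.\<close>

definition L2_tendsto :: "'a measure \<Rightarrow> (nat \<Rightarrow> 'a \<Rightarrow> complex) \<Rightarrow> ('a \<Rightarrow> complex) \<Rightarrow> bool" where
  "L2_tendsto M u g \<longleftrightarrow> (\<forall>n. u n \<in> L2 M) \<and> g \<in> L2 M \<and>
     (\<lambda>n. L2_norm M (\<lambda>x. u n x - g x)) \<longlonglongrightarrow> 0"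

definition UC_lim_L2 :: "'a measure \<Rightarrow> (rat \<Rightarrow> 'a \<Rightarrow> complex) \<Rightarrow> ('a \<Rightarrow> complex) \<Rightarrow> bool" where
  "UC_lim_L2 M v g \<longleftrightarrow> (\<forall>\<Phi>. Folner \<Phi> \<longrightarrow>
     L2_tendsto M (\<lambda>N x. 1 / of_nat (card (\<Phi> N)) * (\<Sum>q\<in>\<Phi> N. v q x)) g)"

end

theory Submission imports Defs begin

text \<open>Subtracting the mean, assume \<open>\<integral> f = 0\<close>; the proof is by induction on \<open>degree P\<close>. In degree one
  this is the mean ergodic theorem, which follows from the existence of convex combinations of
  translates of \<open>f\<close> with arbitrarily small norm, since passing from \<open>f\<close> to such a combination does
  not change the averages asymptotically. In higher degree the correlation of \<open>T (P (q + h)) f\<close> and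
  \<open>T (P (q + h')) f\<close> is that of \<open>T (R q) f\<close> and \<open>f\<close> with \<open>R q = P (q + h) - P (q + h')\<close>, which for
  \<open>h \<noteq> h'\<close> is a nonconstant polynomial of smaller degree, so the van der Corput trick applies.\<close>

section \<open>Mean squares\<close>

text \<open>The square of the L2 norm. Working with it avoids square roots; the triangle inequality
  is replaced throughout by |a + b|^2 \<le> 2 |a|^2 + 2 |b|^2.\<close>

definition mean_square :: "'a measure \<Rightarrow> ('a \<Rightarrow> complex) \<Rightarrow> real" where
  "mean_square M f = (\<integral>x. (cmod (f x))\<^sup>2 \<partial>M)"

text \<open>The index type is arbitrary because averages are taken both over Folner sets and, in the
  van der Corput trick, over \<open>{..<m}\<close>.\<close>

definition set_average :: "'b set \<Rightarrow> ('b \<Rightarrow> 'a \<Rightarrow> complex) \<Rightarrow> 'a \<Rightarrow> complex" where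
  "set_average A v x = 1 / of_nat (card A) * (\<Sum>q\<in>A. v q x)"

lemma L2_norm_eq_sqrt: "L2_norm M f = sqrt (mean_square M f)"
  by (simp add: L2_norm_def mean_square_def)

lemma mean_square_nonneg: "0 \<le> mean_square M f"
  by (simp add: mean_square_def)

lemma L2_measurable [measurable_dest]: "f \<in> L2 M \<Longrightarrow> f \<in> borel_measurable M"
  by (simp add: L2_def)

lemma L2_integrable_square: "f \<in> L2 M \<Longrightarrow> integrable M (\<lambda>x. (cmod (f x))\<^sup>2)"
  by (simp add: L2_def)

lemma cmod_add_sq_le:
  "(cmod (a + b))\<^sup>2 \<le> 2 * (cmod a)\<^sup>2 + 2 * (cmod b)\<^sup>2"
proof -
  have "(cmod (a + b))\<^sup>2 + (cmod (a - b))\<^sup>2 = 2 * (cmod a)\<^sup>2 + 2 * (cmod b)\<^sup>2"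
    by (simp add: cmod_power2) (simp add: power2_eq_square algebra_simps)
  then show ?thesis by (smt (verit) zero_le_power2)
qed

text \<open>Triangle inequality, then Cauchy-Schwarz against the constant vector 1.\<close>

lemma cmod_sum_sq_le:
  "(cmod (\<Sum>i\<in>I. a i))\<^sup>2 \<le> real (card I) * (\<Sum>i\<in>I. (cmod (a i))\<^sup>2)"
proof -
  have "(cmod (\<Sum>i\<in>I. a i))\<^sup>2 \<le> (\<Sum>i\<in>I. cmod (a i))\<^sup>2"
    by (intro power_mono norm_sum) simp
  also have "\<dots> \<le> real (card I) * (\<Sum>i\<in>I. (cmod (a i))\<^sup>2)"
    using sum_squared_le_sum_of_squares[of "\<lambda>i. cmod (a i)" I] by (simp add: mult.commute)
  finally show ?thesis .
qed

lemma L2_boundedI: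
  assumes "f \<in> borel_measurable M" "integrable M g" "\<And>x. (cmod (f x))\<^sup>2 \<le> g x"
  shows "f \<in> L2 M" "mean_square M f \<le> (\<integral>x. g x \<partial>M)"
proof -
  have [measurable]: "f \<in> borel_measurable M" by fact
  have "0 \<le> g x" for x
    using assms(3)[of x] zero_le_power2[of "cmod (f x)"] by linarith
  then have *: "integrable M (\<lambda>x. (cmod (f x))\<^sup>2)"
    by (intro Bochner_Integration.integrable_bound[OF assms(2)]) (auto simp: assms(3))
  then show "f \<in> L2 M" by (simp add: L2_def)
  show "mean_square M f \<le> (\<integral>x. g x \<partial>M)"
    unfolding mean_square_def by (intro integral_mono * assms)
qed

lemma
  assumes f: "f \<in> L2 M" and g: "g \<in> L2 M"
  shows L2_add: "(\<lambda>x. f x + g x) \<in> L2 M"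
    and mean_square_add_le:
      "mean_square M (\<lambda>x. f x + g x) \<le> 2 * mean_square M f + 2 * mean_square M g"
proof -
  note fg = L2_integrable_square[OF f] L2_integrable_square[OF g]
  have m: "(\<lambda>x. f x + g x) \<in> borel_measurable M"
    using f g by measurable
  have i: "integrable M (\<lambda>x. 2 * (cmod (f x))\<^sup>2 + 2 * (cmod (g x))\<^sup>2)"
    using fg by simp
  show "(\<lambda>x. f x + g x) \<in> L2 M"
    by (rule L2_boundedI(1)[OF m i]) (rule cmod_add_sq_le)
  have "mean_square M (\<lambda>x. f x + g x) \<le> (\<integral>x. 2 * (cmod (f x))\<^sup>2 + 2 * (cmod (g x))\<^sup>2 \<partial>M)"
    by (rule L2_boundedI(2)[OF m i]) (rule cmod_add_sq_le)
  then show "mean_square M (\<lambda>x. f x + g x) \<le> 2 * mean_square M f + 2 * mean_square M g"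
    using fg by (simp add: mean_square_def)
qed

lemma L2_scale: "f \<in> L2 M \<Longrightarrow> (\<lambda>x. c * f x) \<in> L2 M"
  by (auto simp: L2_def norm_mult power_mult_distrib)

lemma mean_square_scale: "mean_square M (\<lambda>x. c * f x) = (cmod c)\<^sup>2 * mean_square M f"
  by (simp add: mean_square_def norm_mult power_mult_distrib)

lemma L2_diff: "f \<in> L2 M \<Longrightarrow> g \<in> L2 M \<Longrightarrow> (\<lambda>x. f x - g x) \<in> L2 M"
  using L2_add[OF _ L2_scale[of g M "-1"], of f] by simp

lemma mean_square_diff_le:
  assumes "f \<in> L2 M" "g \<in> L2 M"
  shows "mean_square M (\<lambda>x. f x - g x) \<le> 2 * mean_square M f + 2 * mean_square M g"
  using mean_square_add_le[OF assms(1) L2_scale[OF assms(2), of "-1"]] mean_square_scale[of M "-1" g]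
  by simp

lemma L2_sum: "(\<And>i. i \<in> I \<Longrightarrow> v i \<in> L2 M) \<Longrightarrow> (\<lambda>x. \<Sum>i\<in>I. v i x) \<in> L2 M"
proof (induction I rule: infinite_finite_induct)
  case (insert i I)
  then show ?case using L2_add[of "v i" M "\<lambda>x. \<Sum>i\<in>I. v i x"] by simp
qed (auto simp: L2_def)

lemma mean_square_sum_le:
  assumes "\<And>i. i \<in> I \<Longrightarrow> v i \<in> L2 M"
  shows "mean_square M (\<lambda>x. \<Sum>i\<in>I. v i x) \<le> real (card I) * (\<Sum>i\<in>I. mean_square M (v i))"
proof -
  have i: "integrable M (\<lambda>x. real (card I) * (\<Sum>i\<in>I. (cmod (v i x))\<^sup>2))"
    using assms by (auto intro!: L2_integrable_square)
  have "mean_square M (\<lambda>x. \<Sum>i\<in>I. v i x) \<le> (\<integral>x. real (card I) * (\<Sum>i\<in>I. (cmod (v i x))\<^sup>2) \<partial>M)"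
    using L2_measurable[OF L2_sum[OF assms]] by (rule L2_boundedI(2)[OF _ i]) (auto intro: cmod_sum_sq_le)
  also have "\<dots> = real (card I) * (\<Sum>i\<in>I. mean_square M (v i))"
    using assms by (simp add: mean_square_def L2_integrable_square)
  finally show ?thesis .
qed

lemma L2_set_average: "(\<And>i. i \<in> I \<Longrightarrow> v i \<in> L2 M) \<Longrightarrow> set_average I v \<in> L2 M"
  using L2_scale[OF L2_sum[of I v M], of "1 / of_nat (card I)"] by (simp add: set_average_def[abs_def])

lemma mean_square_set_average_le:
  assumes "\<And>i. i \<in> I \<Longrightarrow> v i \<in> L2 M"
  shows "mean_square M (set_average I v) \<le> (\<Sum>i\<in>I. mean_square M (v i)) / real (card I)"
proof -
  have "mean_square M (set_average I v) = mean_square M (\<lambda>x. \<Sum>i\<in>I. v i x) / (real (card I))\<^sup>2"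
    using mean_square_scale[of M "1 / of_nat (card I)" "\<lambda>x. \<Sum>i\<in>I. v i x"]
    by (simp add: set_average_def[abs_def] norm_divide power_divide)
  also have "\<dots> \<le> real (card I) * (\<Sum>i\<in>I. mean_square M (v i)) / (real (card I))\<^sup>2"
    by (intro divide_right_mono mean_square_sum_le assms) auto
  \<comment> \<open>If \<open>card I\<close> is 0, both sides are 0 because division by 0 gives
    0.\<close>
  also have "\<dots> = (\<Sum>i\<in>I. mean_square M (v i)) / real (card I)"
    by (simp add: power2_eq_square)
  finally show ?thesis .
qed

text \<open>Phrased with the midpoint because the orbit hull below is closed under
  midpoints.\<close>

lemma parallelogram_mean_square:
  assumes f: "f \<in> L2 M" and g: "g \<in> L2 M"
  shows "mean_square M (\<lambda>x. f x - g x) =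
    2 * mean_square M f + 2 * mean_square M g - 4 * mean_square M (\<lambda>x. (f x + g x) / 2)"
proof -
  note i = L2_integrable_square[OF f] L2_integrable_square[OF g] L2_integrable_square[OF L2_add[OF f g]]
  have "mean_square M (\<lambda>x. f x - g x) =
      (\<integral>x. 2 * (cmod (f x))\<^sup>2 + 2 * (cmod (g x))\<^sup>2 - (cmod (f x + g x))\<^sup>2 \<partial>M)"
    unfolding mean_square_def
    by (intro Bochner_Integration.integral_cong refl)
      (simp add: cmod_power2, simp add: power2_eq_square algebra_simps)
  also have "\<dots> = 2 * mean_square M f + 2 * mean_square M g - mean_square M (\<lambda>x. f x + g x)"
    using i by (simp add: mean_square_def)
  also have "mean_square M (\<lambda>x. f x + g x) = 4 * mean_square M (\<lambda>x. (f x + g x) / 2)"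
    using mean_square_scale[of M "1/2" "\<lambda>x. f x + g x"] by (simp add: power2_eq_square)
  finally show ?thesis .
qed

section \<open>Real inner products and the Cauchy-Schwarz inequality\<close>

lemma integrable_inner_L2:
  assumes f: "f \<in> L2 M" and g: "g \<in> L2 M"
  shows "integrable M (\<lambda>x. f x \<bullet> g x)"
proof (rule Bochner_Integration.integrable_bound)
  show "integrable M (\<lambda>x. (cmod (f x))\<^sup>2 + (cmod (g x))\<^sup>2)"
    using f g by (simp add: L2_integrable_square)
  show "(\<lambda>x. f x \<bullet> g x) \<in> borel_measurable M"
    using f g by measurable
  \<comment> \<open>On complex numbers \<open>\<bullet>\<close> is the real inner product Re (a *
    cnj b). The proof only needs it to expand squared norms, so the complex inner product never
    appears.\<close>
  have "\<bar>a \<bullet> b\<bar> \<le> (cmod a)\<^sup>2 + (cmod b)\<^sup>2" for a b :: complex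
    using Cauchy_Schwarz_ineq2[of a b] sum_squares_bound[of "cmod a" "cmod b"]
      mult_nonneg_nonneg[of "cmod a" "cmod b"] by auto
  then show "AE x in M. norm (f x \<bullet> g x) \<le> norm ((cmod (f x))\<^sup>2 + (cmod (g x))\<^sup>2)"
    by auto
qed

text \<open>The value at \<open>t = \<integral> f \<bullet> g / \<integral> |g|\<^sup>2\<close> of the nonnegative quadratic
  \<open>t \<mapsto> \<integral> |f - t g|\<^sup>2\<close>; for \<open>\<integral> |g|\<^sup>2 = 0\<close> the function \<open>g\<close> vanishes almost everywhere.\<close>

lemma Cauchy_Schwarz_L2:
  assumes f: "f \<in> L2 M" and g: "g \<in> L2 M"
  shows "(\<integral>x. f x \<bullet> g x \<partial>M)\<^sup>2 \<le> mean_square M f * mean_square M g"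
proof (cases "mean_square M g = 0")
  case True
  then have "AE x in M. g x = 0"
    using integral_nonneg_eq_0_iff_AE[OF L2_integrable_square[OF g]] by (simp add: mean_square_def)
  then have "(\<integral>x. f x \<bullet> g x \<partial>M) = (\<integral>x. 0 \<partial>M)"
    using f g by (intro integral_cong_AE) auto
  then show ?thesis using True by simp
next
  case False
  then have pos: "mean_square M g > 0"
    using mean_square_nonneg[of M g] by simp
  define B where "B = (\<integral>x. f x \<bullet> g x \<partial>M)"
  define t where "t = B / mean_square M g"
  note i = L2_integrable_square[OF f] L2_integrable_square[OF g] integrable_inner_L2[OF f g]
  have "0 \<le> mean_square M (\<lambda>x. f x - of_real t * g x)" by (rule mean_square_nonneg)
  also have "\<dots> = (\<integral>x. (cmod (f x))\<^sup>2 - 2 * t * (f x \<bullet> g x) + t\<^sup>2 * (cmod (g x))\<^sup>2 \<partial>M)"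
    unfolding mean_square_def
    by (intro Bochner_Integration.integral_cong refl)
      (simp add: cmod_power2 inner_complex_def, simp add: power2_eq_square algebra_simps)
  also have "\<dots> = mean_square M f - 2 * t * B + t\<^sup>2 * mean_square M g"
    using i by (simp add: mean_square_def B_def)
  also have "\<dots> = mean_square M f - B\<^sup>2 / mean_square M g"
    using pos by (simp add: t_def power2_eq_square field_simps)
  finally show ?thesis
    using pos by (simp add: B_def field_simps)
qed

section \<open>Bounds that rely on total mass one\<close>

lemma (in prob_space) L2_const: "(\<lambda>x. c) \<in> L2 M"
  by (simp add: L2_def)

lemma (in prob_space) integrable_L2:
  assumes "f \<in> L2 M"
  shows "integrable M f"
proof -
  have "integrable M (\<lambda>x. cmod (f x))"
    by (rule square_integrable_imp_integrable[OF _ L2_integrable_square[OF assms]]) (use assms in simp)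
  then show ?thesis
    using integrable_norm_iff[OF L2_measurable[OF assms]] by simp
qed

text \<open>The difference of the two sides is the variance of |f|. This turns L2 estimates into L1
  estimates.\<close>

lemma (in prob_space) integral_cmod_sq_le:
  assumes "f \<in> L2 M"
  shows "(\<integral>x. cmod (f x) \<partial>M)\<^sup>2 \<le> mean_square M f"
proof -
  have "variance (\<lambda>x. cmod (f x)) = mean_square M f - (\<integral>x. cmod (f x) \<partial>M)\<^sup>2"
    unfolding mean_square_def
    by (intro variance_eq integrable_norm integrable_L2 L2_integrable_square assms)
  then show ?thesis
    using variance_positive[of "\<lambda>x. cmod (f x)"] by linarith
qed

lemma (in prob_space) cmod_integral_sq_le:
  assumes "f \<in> L2 M"
  shows "(cmod (\<integral>x. f x \<partial>M))\<^sup>2 \<le> mean_square M f"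
proof -
  have "(cmod (\<integral>x. f x \<partial>M))\<^sup>2 \<le> (\<integral>x. cmod (f x) \<partial>M)\<^sup>2"
    by (intro power_mono integral_norm_bound) simp
  with integral_cmod_sq_le[OF assms] show ?thesis by (rule order_trans[rotated])
qed

section \<open>Invariant functions\<close>

context Q_system
begin

lemma space_M: "space M = X"
  using sets_eq_imp_space_eq[OF borel_M] by (simp add: space_restrict_space)

lemma T_in_X: "x \<in> X \<Longrightarrow> T q x \<in> X"
  using homeo_T[of q] unfolding homeomorphism_def by blast

lemma measurable_T [measurable]: "T q \<in> measurable M M"
proof -
  have "continuous_on X (T q)" using homeo_T[of q] unfolding homeomorphism_def by blast
  then have "T q \<in> measurable (restrict_space borel X) borel"
    by (rule borel_measurable_continuous_on_restrict)
  then have "T q \<in> measurable (restrict_space borel X) (restrict_space borel X)"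
    by (intro measurable_restrict_space2) (auto simp: space_restrict_space T_in_X)
  then show ?thesis
    using measurable_cong_sets[OF borel_M borel_M] by simp
qed

lemma distr_T: "distr M M (T q) = M"
  using invariant by (intro measure_eqI) (auto simp: emeasure_distr space_M)

lemma integral_T:
  fixes g :: "'a \<Rightarrow> 'b::{banach, second_countable_topology}"
  assumes "g \<in> borel_measurable M"
  shows "(\<integral>x. g (T q x) \<partial>M) = (\<integral>x. g x \<partial>M)"
  using integral_distr[OF measurable_T assms, of q] by (simp add: distr_T)

lemma integrable_T:
  fixes g :: "'a \<Rightarrow> 'b::{banach, second_countable_topology}"
  assumes "integrable M g"
  shows "integrable M (\<lambda>x. g (T q x))"
  using integrable_distr[OF measurable_T, of q g] assms unfolding distr_T by blast

lemma L2_T: "f \<in> L2 M \<Longrightarrow> (\<lambda>x. f (T q x)) \<in> L2 M"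
  using integrable_T[of "\<lambda>x. (cmod (f x))\<^sup>2" q] by (auto simp: L2_def)

lemma mean_square_T: "f \<in> L2 M \<Longrightarrow> mean_square M (\<lambda>x. f (T q x)) = mean_square M f"
  using integral_T[of "\<lambda>x. (cmod (f x))\<^sup>2" q] by (simp add: mean_square_def L2_measurable)

end

text \<open>Fatou's lemma for the squared moduli. It will be applied to the differences of a Cauchy
  sequence with one index fixed, which is why the bound is only eventual.\<close>

lemma L2_Fatou:
  assumes u: "\<And>n. u n \<in> L2 M" and g: "g \<in> borel_measurable M"
    and lim: "AE x in M. (\<lambda>n. u n x) \<longlonglongrightarrow> g x"
    and bound: "eventually (\<lambda>n. mean_square M (u n) \<le> C) sequentially" and C: "0 \<le> C"
  shows "g \<in> L2 M" "mean_square M g \<le> C"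
proof -
  note [measurable] = g L2_measurable[OF u]
  have "(\<integral>\<^sup>+x. ennreal ((cmod (g x))\<^sup>2) \<partial>M) = (\<integral>\<^sup>+x. liminf (\<lambda>n. ennreal ((cmod (u n x))\<^sup>2)) \<partial>M)"
  proof (rule nn_integral_cong_AE, use lim in eventually_elim)
    case (elim x)
    then have "(\<lambda>n. ennreal ((cmod (u n x))\<^sup>2)) \<longlonglongrightarrow> ennreal ((cmod (g x))\<^sup>2)"
      by (intro tendsto_ennrealI tendsto_power tendsto_norm)
    then show ?case
      using lim_imp_Liminf[OF trivial_limit_sequentially] by metis
  qed
  also have "\<dots> \<le> liminf (\<lambda>n. \<integral>\<^sup>+x. ennreal ((cmod (u n x))\<^sup>2) \<partial>M)"
    by (rule nn_integral_liminf) measurable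
  also have "\<dots> = liminf (\<lambda>n. ennreal (mean_square M (u n)))"
    by (simp add: mean_square_def nn_integral_eq_integral L2_integrable_square[OF u])
  also have "\<dots> \<le> limsup (\<lambda>n. ennreal (mean_square M (u n)))"
    by (rule Liminf_le_Limsup) simp
  also have "\<dots> \<le> ennreal C"
    by (rule Limsup_bounded, use bound in eventually_elim) (rule ennreal_leI)
  finally have le: "(\<integral>\<^sup>+x. ennreal ((cmod (g x))\<^sup>2) \<partial>M) \<le> ennreal C" .
  then have "(\<integral>\<^sup>+x. ennreal ((cmod (g x))\<^sup>2) \<partial>M) < \<infinity>"
    by (rule le_less_trans) simp
  then have int: "integrable M (\<lambda>x. (cmod (g x))\<^sup>2)"
    by (intro integrableI_nonneg) auto
  then show "g \<in> L2 M" by (simp add: L2_def)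
  show "mean_square M g \<le> C"
    using le C by (simp add: nn_integral_eq_integral[OF int] mean_square_def)
qed

section \<open>Ergodicity: invariant functions are constant\<close>

context ergodic_Q_system
begin

text \<open>Replacing \<open>A\<close> by \<open>\<Inter>q. T q -` A\<close>, a countable intersection, makes it strictly invariant.\<close>

lemma AE_invariant_set:
  assumes A [measurable]: "A \<in> sets M" and inv: "\<And>q. AE x in M. T q x \<in> A \<longleftrightarrow> x \<in> A"
  shows "(AE x in M. x \<in> A) \<or> (AE x in M. x \<notin> A)"
proof -
  define B where "B = {x \<in> space M. \<forall>q. T q x \<in> A}"
  have B [measurable]: "B \<in> sets M" unfolding B_def by measurable
  have "T p -` B \<inter> X = B" for p
  proof (intro set_eqI iffI)
    fix x assume "x \<in> T p -` B \<inter> X"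
    then have "x \<in> X" and *: "\<And>q. T q (T p x) \<in> A" by (auto simp: B_def)
    have "T q x \<in> A" for q
      using *[of "q - p"] action_add[OF \<open>x \<in> X\<close>, of "q - p" p] by simp
    then show "x \<in> B" using \<open>x \<in> X\<close> by (simp add: B_def space_M)
  next
    fix x assume "x \<in> B"
    then show "x \<in> T p -` B \<inter> X"
      by (auto simp: B_def space_M T_in_X action_add[symmetric])
  qed
  then have "emeasure M B = 0 \<or> emeasure M (X - B) = 0"
    by (intro ergodic B)
  then have B_AE: "(AE x in M. x \<notin> B) \<or> (AE x in M. x \<in> B)"
  proof
    assume "emeasure M B = 0"
    then have "AE x in M. x \<notin> B" by (intro AE_not_in null_setsI B)
    then show ?thesis ..
  next
    assume "emeasure M (X - B) = 0"
    then have "AE x in M. x \<notin> X - B"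
      using sets.compl_sets[OF B] by (intro AE_not_in null_setsI) (auto simp: space_M)
    then have "AE x in M. x \<in> B"
      using AE_space by eventually_elim (auto simp: space_M)
    then show ?thesis ..
  qed
  \<comment> \<open>Since the rationals are countable, the exceptional null sets of the single
    \<open>q\<close> can be united. Off their union, \<open>B\<close> and \<open>A\<close>
    agree.\<close>
  have "AE x in M. \<forall>q. T q x \<in> A \<longleftrightarrow> x \<in> A"
    using inv by (simp add: AE_all_countable)
  then have "AE x in M. x \<in> B \<longleftrightarrow> x \<in> A"
    using AE_space by eventually_elim (auto simp: B_def)
  then have "(AE x in M. x \<in> B) \<longleftrightarrow> (AE x in M. x \<in> A)" "(AE x in M. x \<notin> B) \<longleftrightarrow> (AE x in M. x \<notin> A)"
    by (auto elim: AE_mp)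
  with B_AE show ?thesis by blast
qed

text \<open>The set where \<open>h\<close> exceeds its mean is invariant, hence null or conull. If
  it were conull, the mean would be strictly larger than itself.\<close>

lemma AE_invariant_le_integral:
  fixes h :: "'a \<Rightarrow> real"
  assumes h: "integrable M h" and inv: "\<And>q. AE x in M. h (T q x) = h x"
  shows "AE x in M. h x \<le> (\<integral>x. h x \<partial>M)"
proof -
  let ?c = "\<integral>x. h x \<partial>M"
  define A where "A = {x \<in> space M. ?c < h x}"
  have A: "A \<in> sets M" unfolding A_def using h by measurable
  have "AE x in M. T q x \<in> A \<longleftrightarrow> x \<in> A" for q
    using inv[of q] AE_space by eventually_elim (auto simp: A_def space_M T_in_X)
  from AE_invariant_set[OF A this] show ?thesis
  proof
    assume "AE x in M. x \<in> A"
    then have "AE x in M. ?c < h x" by eventually_elim (simp add: A_def)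
    then have "(\<integral>x. ?c \<partial>M) < ?c"
      using h by (intro integral_less_AE_space) (auto simp: emeasure_space_1)
    then show ?thesis by (simp add: prob_space)
  next
    assume "AE x in M. x \<notin> A"
    then show ?thesis using AE_space by eventually_elim (auto simp: A_def)
  qed
qed

text \<open>Apply the previous inequality to \<open>h\<close> and \<open>- h\<close>, where
  \<open>h\<close> is the real or the imaginary part.\<close>

lemma AE_invariant_const:
  fixes g :: "'a \<Rightarrow> complex"
  assumes g: "integrable M g" and inv: "\<And>q. AE x in M. g (T q x) = g x"
  shows "AE x in M. g x = (\<integral>x. g x \<partial>M)"
proof -
  have real_case: "AE x in M. h x = (\<integral>x. h x \<partial>M)"
    if h: "integrable M h" "\<And>q. AE x in M. h (T q x) = h x" for h :: "'a \<Rightarrow> real"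
  proof -
    have "AE x in M. - h x \<le> (\<integral>x. - h x \<partial>M)"
      using h by (intro AE_invariant_le_integral) auto
    with AE_invariant_le_integral[OF h] show ?thesis by eventually_elim simp
  qed
  have "AE x in M. Re (g x) = (\<integral>x. Re (g x) \<partial>M)"
  proof (rule real_case)
    show "integrable M (\<lambda>x. Re (g x))" using g by simp
    show "AE x in M. Re (g (T q x)) = Re (g x)" for q
      using inv[of q] by eventually_elim simp
  qed
  moreover have "AE x in M. Im (g x) = (\<integral>x. Im (g x) \<partial>M)"
  proof (rule real_case)
    show "integrable M (\<lambda>x. Im (g x))" using g by simp
    show "AE x in M. Im (g (T q x)) = Im (g x)" for q
      using inv[of q] by eventually_elim simp
  qed
  ultimately show ?thesis
    by eventually_elim (simp add: complex_eq_iff g)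
qed

end

section \<open>Elements of small norm in the convex hull of an orbit\<close>

context Q_system
begin

text \<open>The dyadic convex combinations of translates of \<open>f\<close>. Midpoints are all that
  the parallelogram law asks for, and properties of the averages can be proved by rule
  induction.\<close>

inductive_set orbit_hull :: "('a \<Rightarrow> complex) \<Rightarrow> ('a \<Rightarrow> complex) set" for f where
  base: "f \<in> orbit_hull f"
| shift: "g \<in> orbit_hull f \<Longrightarrow> (\<lambda>x. g (T q x)) \<in> orbit_hull f"
| midpoint: "g \<in> orbit_hull f \<Longrightarrow> h \<in> orbit_hull f \<Longrightarrow> (\<lambda>x. (g x + h x) / 2) \<in> orbit_hull f"

lemma L2_midpoint: "g \<in> L2 M \<Longrightarrow> h \<in> L2 M \<Longrightarrow> (\<lambda>x. (g x + h x) / 2) \<in> L2 M"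
  using L2_scale[OF L2_add, of g M h "1/2"] by simp

lemma orbit_hull_L2:
  assumes "g \<in> orbit_hull f" "f \<in> L2 M"
  shows "g \<in> L2 M"
  using assms by induction (auto intro: L2_T L2_midpoint)

lemma orbit_hull_integral:
  assumes "g \<in> orbit_hull f" "f \<in> L2 M"
  shows "(\<integral>x. g x \<partial>M) = (\<integral>x. f x \<partial>M)"
  using assms
proof induction
  case (shift g q)
  then show ?case using integral_T[of g q] orbit_hull_L2[of g f] by (simp add: L2_measurable)
next
  case (midpoint g h)
  then show ?case using orbit_hull_L2[of g f] orbit_hull_L2[of h f]
    by (simp add: integrable_L2)
qed simp

end

text \<open>By the parallelogram law a minimising sequence of the hull is Cauchy and asymptotically
  invariant, so its limit is an invariant function, hence the constant \<open>\<integral> f = 0\<close>.\<close>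

lemma (in ergodic_Q_system) orbit_hull_small:
  assumes f: "f \<in> L2 M" and zero: "(\<integral>x. f x \<partial>M) = 0" and e: "e > 0"
  shows "\<exists>g \<in> orbit_hull f. mean_square M g < e"
proof -
  let ?K = "orbit_hull f"
  define d where "d = Inf (mean_square M ` ?K)"
  have bdd: "bdd_below (mean_square M ` ?K)"
    by (rule bdd_belowI[of _ 0]) (auto simp: mean_square_nonneg)
  have d_le: "d \<le> mean_square M g" if "g \<in> ?K" for g
    unfolding d_def using that by (intro cInf_lower bdd) simp
  \<comment> \<open>The midpoint of \<open>g\<close> and \<open>h\<close> lies in the hull, so its
    mean square is at least \<open>d\<close>; the parallelogram law does the rest.\<close>
  have diff: "mean_square M (\<lambda>x. g x - h x) \<le> 2 * (mean_square M g - d) + 2 * (mean_square M h - d)"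
    if g: "g \<in> ?K" and h: "h \<in> ?K" for g h
    using parallelogram_mean_square[OF orbit_hull_L2[OF g f] orbit_hull_L2[OF h f]]
      d_le[OF orbit_hull.midpoint[OF g h]] by simp
  have "\<exists>g \<in> ?K. mean_square M g < d + 1 / real (Suc n)" for n
  proof -
    have "Inf (mean_square M ` ?K) < d + 1 / real (Suc n)" by (simp add: d_def)
    then show ?thesis
      using cInf_lessD[of "mean_square M ` ?K"] orbit_hull.base[of f] by blast
  qed
  then obtain s where s_K: "\<And>n. s n \<in> ?K" and s_d: "\<And>n. mean_square M (s n) < d + 1 / real (Suc n)"
    by metis
  have s_L2: "s n \<in> L2 M" for n using orbit_hull_L2[OF s_K f] .
  have s_near: "mean_square M (s n) - d \<le> 1 / real (Suc k)" if "k \<le> n" for n k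
  proof -
    have "1 / real (Suc n) \<le> 1 / real (Suc k)" using that by (simp add: frac_le)
    with s_d[of n] show ?thesis by linarith
  qed
  have s_diff: "mean_square M (\<lambda>x. s i x - s j x) \<le> 4 / real (Suc k)" if "k \<le> i" "k \<le> j" for i j k
    using diff[OF s_K[of i] s_K[of j]] s_near[OF that(1)] s_near[OF that(2)] by simp
  \<comment> \<open>The sequence is Cauchy in L1 as well, and therefore has a subsequence that is
    Cauchy almost everywhere. The \<open>e\<close> here shadows the one of the lemma.\<close>
  have "\<exists>N. \<forall>i\<ge>N. \<forall>j\<ge>N. (\<integral>x. norm (s i x - s j x) \<partial>M) < e" if "e > 0" for e :: real
  proof -
    obtain N where N: "4 / e\<^sup>2 < real (Suc N)"
      using reals_Archimedean2 less_trans of_nat_less_iff lessI by meson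
    have small: "4 / real (Suc N) < e\<^sup>2"
      using N \<open>e > 0\<close> by (simp add: field_simps)
    have "(\<integral>x. cmod (s i x - s j x) \<partial>M) < e" if "i \<ge> N" "j \<ge> N" for i j
    proof (rule power2_less_imp_less)
      show "(\<integral>x. cmod (s i x - s j x) \<partial>M)\<^sup>2 < e\<^sup>2"
        using integral_cmod_sq_le[OF L2_diff[OF s_L2[of i] s_L2[of j]]] s_diff[OF that] small
        by linarith
      show "0 \<le> e" using \<open>e > 0\<close> by simp
    qed
    then show ?thesis by blast
  qed
  with integrable_L2[OF s_L2] obtain r where r: "strict_mono r"
    and Cau: "AE x in M. Cauchy (\<lambda>i. s (r i) x)"
    by (rule cauchy_L1_AE_cauchy_subseq)
  define k where "k n = s (r n)" for n
  \<comment> \<open>Where the sequence diverges, which happens on a null set only, the value of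
    \<open>lim\<close> is irrelevant; \<open>g\<close> is measurable all the same.\<close>
  define g where "g x = lim (\<lambda>n. k n x)" for x
  have k_K: "k n \<in> ?K" and k_L2: "k n \<in> L2 M" for n by (simp_all add: k_def s_K s_L2)
  have r_ge: "n \<le> r n" for n using seq_suble[OF r] .
  note [measurable] = L2_measurable[OF k_L2]
  have g_meas [measurable]: "g \<in> borel_measurable M" unfolding g_def[abs_def] by measurable
  have k_lim: "AE x in M. (\<lambda>n. k n x) \<longlonglongrightarrow> g x"
    using Cau by eventually_elim
      (simp add: g_def k_def Cauchy_convergent_iff convergent_LIMSEQ_iff)
  \<comment> \<open>Fatou's lemma as m tends to infinity with n fixed; both \<open>r n\<close> and
    \<open>r m\<close> are at least n, so \<open>s_diff\<close> applies.\<close>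
  have kg: "(\<lambda>x. k n x - g x) \<in> L2 M" "mean_square M (\<lambda>x. k n x - g x) \<le> 4 / real (Suc n)" for n
  proof -
    have lim: "AE x in M. (\<lambda>m. k n x - k m x) \<longlonglongrightarrow> k n x - g x"
      using k_lim by eventually_elim (intro tendsto_diff tendsto_const)
    have bound: "\<forall>\<^sub>F m in sequentially. mean_square M (\<lambda>x. k n x - k m x) \<le> 4 / real (Suc n)"
      using eventually_ge_at_top[of n]
    proof eventually_elim
      case (elim m)
      then have "n \<le> r m" using r_ge[of m] by linarith
      then show ?case unfolding k_def by (intro s_diff r_ge)
    qed
    note * = L2_Fatou[OF L2_diff[OF k_L2 k_L2] _ lim bound]
    show "(\<lambda>x. k n x - g x) \<in> L2 M" by (rule *(1)) auto
    show "mean_square M (\<lambda>x. k n x - g x) \<le> 4 / real (Suc n)" by (rule *(2)) auto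
  qed
  have g_L2: "g \<in> L2 M"
    using L2_diff[OF k_L2[of 0] kg(1)[of 0]] by simp
  have zeroI: "a \<le> 0" if "\<And>n. a \<le> c / real (Suc n)" for a c :: real
    by (rule LIMSEQ_le_const[OF LIMSEQ_Suc[OF lim_const_over_n[of c]]]) (use that in blast)
  have g_inv: "AE x in M. g (T q x) = g x" for q
  proof -
    let ?D = "\<lambda>x. g x - g (T q x)"
    have D: "?D \<in> L2 M" by (intro L2_diff L2_T g_L2)
    \<comment> \<open>With \<open>?a\<close> and \<open>?b\<close> both of mean square at most 4 /
      (n + 1), two uses of the doubled triangle inequality give 2 * (2 * 4 + 2 * 4) + 2 * 4 =
      40.\<close>
    have "mean_square M ?D \<le> 40 / real (Suc n)" for n
    proof -
      let ?a = "\<lambda>x. k n x - g x" and ?b = "\<lambda>x. k n x - k n (T q x)"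
      have b: "?b \<in> L2 M" by (intro L2_diff L2_T k_L2)
      have "mean_square M ?b \<le> 2 * (mean_square M (k n) - d) + 2 * (mean_square M (k n) - d)"
        using diff[OF k_K[of n] orbit_hull.shift[OF k_K[of n], of q]] mean_square_T[OF k_L2[of n], of q]
        by simp
      also have "\<dots> \<le> 4 / real (Suc n)"
        using s_near[OF r_ge[of n]] by (simp add: k_def)
      finally have b_le: "mean_square M ?b \<le> 4 / real (Suc n)" .
      have "?D = (\<lambda>x. (?b x + ?a (T q x)) - ?a x)" by (auto simp: fun_eq_iff)
      then have "mean_square M ?D \<le> 2 * mean_square M (\<lambda>x. ?b x + ?a (T q x)) + 2 * mean_square M ?a"
        using mean_square_diff_le[OF L2_add[OF b L2_T[OF kg(1)[of n], of q]] kg(1)[of n]] by simp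
      also have "mean_square M (\<lambda>x. ?b x + ?a (T q x)) \<le> 2 * mean_square M ?b + 2 * mean_square M ?a"
        using mean_square_add_le[OF b L2_T[OF kg(1)[of n], of q]] mean_square_T[OF kg(1)[of n], of q] by simp
      finally show ?thesis using b_le kg(2)[of n] by simp
    qed
    then have "mean_square M ?D \<le> 0" by (rule zeroI)
    then have "mean_square M ?D = 0" by (intro antisym mean_square_nonneg)
    then have "AE x in M. (cmod (?D x))\<^sup>2 = 0"
      using integral_nonneg_eq_0_iff_AE[OF L2_integrable_square[OF D]] by (simp add: mean_square_def)
    then show ?thesis by eventually_elim simp
  qed
  \<comment> \<open>Every member of the hull has integral 0 like \<open>f\<close>, and L2
    convergence preserves this.\<close>
  have "(cmod (\<integral>x. g x \<partial>M))\<^sup>2 \<le> 4 / real (Suc n)" for n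
  proof -
    have "(\<integral>x. k n x - g x \<partial>M) = - (\<integral>x. g x \<partial>M)"
      using orbit_hull_integral[OF k_K f, of n] zero
      by (simp add: integrable_L2 k_L2 g_L2)
    then show ?thesis
      using cmod_integral_sq_le[OF kg(1)[of n]] kg(2)[of n] by simp
  qed
  then have "(cmod (\<integral>x. g x \<partial>M))\<^sup>2 \<le> 0" by (rule zeroI)
  then have g_0: "AE x in M. g x = 0"
    using AE_invariant_const[OF integrable_L2[OF g_L2] g_inv] by simp
  obtain n where n: "4 / e < real (Suc n)"
    using reals_Archimedean2 less_trans of_nat_less_iff lessI by meson
  \<comment> \<open>As the limit vanishes almost everywhere, the \<open>k n\<close> themselves are
    small; thus the infimum \<open>d\<close> is 0.\<close>
  have "mean_square M (k n) = mean_square M (\<lambda>x. k n x - g x)"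
    unfolding mean_square_def using g_0 by (intro integral_cong_AE) auto
  also have "\<dots> \<le> 4 / real (Suc n)" by (rule kg(2))
  also have "\<dots> < e" using n e by (simp add: field_simps)
  finally show ?thesis using k_K by blast
qed

section \<open>Averages along Folner sequences\<close>

text \<open>The sums over \<open>F\<close> and \<open>F + h\<close> cancel on the intersection and
  leave a signed sum over the symmetric difference. One factor of its cardinality comes from
  Cauchy-Schwarz, the other from bounding each term by \<open>C\<close>.\<close>

lemma mean_square_average_shift_le:
  fixes v :: "rat \<Rightarrow> 'a \<Rightarrow> complex" and h :: rat
  assumes F: "finite F" and v: "\<And>q. v q \<in> L2 M" and C: "\<And>q. mean_square M (v q) \<le> C"
  shows "mean_square M (\<lambda>x. set_average F v x - set_average F (\<lambda>q. v (q + h)) x) \<le>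
    C * (real (card (sym_diff ((\<lambda>q. q + h) ` F) F)) / real (card F))\<^sup>2"
proof -
  define G where "G = (\<lambda>q. q + h) ` F"
  define D where "D = sym_diff G F"
  \<comment> \<open>The sign is +1 on \<open>F - G\<close> and -1 on \<open>G - F\<close>.\<close>
  define w where "w q x = (if q \<in> F then 1 else - 1) * v q x" for q x
  have fin: "finite G" using F by (simp add: G_def)
  have w: "w q \<in> L2 M" for q unfolding w_def[abs_def] by (rule L2_scale) (rule v)
  have w_C: "mean_square M (w q) \<le> C" for q
    using C[of q] unfolding w_def[abs_def] by (simp add: mean_square_scale del: mult_minus1)
  have "(\<Sum>q\<in>F. v q x) - (\<Sum>q\<in>F. v (q + h) x) = (\<Sum>q\<in>D. w q x)" for x
  proof -
    have "(\<Sum>q\<in>F. v (q + h) x) = (\<Sum>q\<in>G. v q x)"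
      unfolding G_def by (subst sum.reindex) (auto simp: inj_on_def)
    also have "\<dots> = (\<Sum>q\<in>G - F. v q x) + (\<Sum>q\<in>G \<inter> F. v q x)"
      using fin by (subst sum.Int_Diff[of _ _ F]) (auto simp: add.commute)
    finally have 1: "(\<Sum>q\<in>F. v (q + h) x) = (\<Sum>q\<in>G - F. v q x) + (\<Sum>q\<in>G \<inter> F. v q x)" .
    have 2: "(\<Sum>q\<in>F. v q x) = (\<Sum>q\<in>F - G. v q x) + (\<Sum>q\<in>G \<inter> F. v q x)"
      using F by (subst sum.Int_Diff[of _ _ G]) (auto simp: add.commute Int_commute)
    have "(\<Sum>q\<in>D. w q x) = (\<Sum>q\<in>G - F. w q x) + (\<Sum>q\<in>F - G. w q x)"
      unfolding D_def using F fin by (intro sum.union_disjoint) auto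
    also have "(\<Sum>q\<in>G - F. w q x) = - (\<Sum>q\<in>G - F. v q x)"
      unfolding sum_negf[symmetric] by (intro sum.cong) (auto simp: w_def)
    also have "(\<Sum>q\<in>F - G. w q x) = (\<Sum>q\<in>F - G. v q x)"
      by (intro sum.cong) (auto simp: w_def)
    finally show ?thesis using 1 2 by simp
  qed
  then have "(\<lambda>x. set_average F v x - set_average F (\<lambda>q. v (q + h)) x) =
      (\<lambda>x. 1 / of_nat (card F) * (\<Sum>q\<in>D. w q x))"
    by (simp add: set_average_def fun_eq_iff diff_divide_distrib[symmetric])
  then have "mean_square M (\<lambda>x. set_average F v x - set_average F (\<lambda>q. v (q + h)) x) =
      (1 / real (card F))\<^sup>2 * mean_square M (\<lambda>x. \<Sum>q\<in>D. w q x)"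
    by (simp only: mean_square_scale) (simp add: norm_divide)
  also have "\<dots> \<le> (1 / real (card F))\<^sup>2 * (real (card D) * (\<Sum>q\<in>D. mean_square M (w q)))"
    by (intro mult_left_mono mean_square_sum_le w) simp
  also have "\<dots> \<le> (1 / real (card F))\<^sup>2 * (real (card D) * (real (card D) * C))"
    by (intro mult_left_mono sum_bounded_above w_C) auto
  also have "\<dots> = C * (real (card D) / real (card F))\<^sup>2"
    by (simp add: power2_eq_square)
  finally show ?thesis by (simp add: D_def G_def)
qed

lemma Folner_finite: "Folner \<Phi> \<Longrightarrow> finite (\<Phi> N)"
  and Folner_card_pos: "Folner \<Phi> \<Longrightarrow> card (\<Phi> N) > 0"
  by (auto simp: Folner_def card_gt_0_iff)

text \<open>The asymptotic half of \<open>Folner\<close> enters the proof only through this lemma;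
  elsewhere only finiteness and nonemptiness are used.\<close>

lemma Folner_average_shift:
  fixes v :: "rat \<Rightarrow> 'a \<Rightarrow> complex" and h :: rat
  assumes \<Phi>: "Folner \<Phi>" and v: "\<And>q. v q \<in> L2 M" and C: "\<And>q. mean_square M (v q) \<le> C"
  shows "(\<lambda>N. mean_square M (\<lambda>x. set_average (\<Phi> N) v x - set_average (\<Phi> N) (\<lambda>q. v (q + h)) x))
    \<longlonglongrightarrow> 0"
proof (rule real_tendsto_sandwich[where f = "\<lambda>_. 0"])
  have "(\<lambda>N. real (card (sym_diff ((\<lambda>q. q + h) ` \<Phi> N) (\<Phi> N))) / real (card (\<Phi> N))) \<longlonglongrightarrow> 0"
    using \<Phi> by (simp add: Folner_def)
  from tendsto_mult[OF tendsto_const[of C] tendsto_power[OF this, of 2]]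
  show "(\<lambda>N. C * (real (card (sym_diff ((\<lambda>q. q + h) ` \<Phi> N) (\<Phi> N))) / real (card (\<Phi> N)))\<^sup>2) \<longlonglongrightarrow> 0"
    by simp
  show "\<forall>\<^sub>F N in sequentially. mean_square M (\<lambda>x. set_average (\<Phi> N) v x - set_average (\<Phi> N) (\<lambda>q. v (q + h)) x)
      \<le> C * (real (card (sym_diff ((\<lambda>q. q + h) ` \<Phi> N) (\<Phi> N))) / real (card (\<Phi> N)))\<^sup>2"
    by (intro always_eventually allI mean_square_average_shift_le Folner_finite \<Phi> v C)
qed (auto intro: always_eventually mean_square_nonneg)

lemma mean_square_tendsto_0I:
  assumes "\<And>e. e > 0 \<Longrightarrow> eventually (\<lambda>N. mean_square M (u N) < e) F"
  shows "((\<lambda>N. mean_square M (u N)) \<longlongrightarrow> 0) F"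
  using assms by (intro order_tendstoI)
    (auto intro: always_eventually less_le_trans[OF _ mean_square_nonneg])

text \<open>The van der Corput trick: replace \<open>v q\<close> by the average of \<open>v (q + i)\<close> over \<open>i < m\<close>, which
  the Folner property permits. Only the diagonal correlations survive, and they contribute at
  most \<open>C / m\<close>.\<close>

lemma van_der_Corput:
  fixes v :: "rat \<Rightarrow> 'a \<Rightarrow> complex"
  assumes \<Phi>: "Folner \<Phi>" and v: "\<And>q. v q \<in> L2 M" and C: "\<And>q. mean_square M (v q) \<le> C"
    and corr: "\<And>h h'. h \<noteq> h' \<Longrightarrow>
      (\<lambda>N. (\<Sum>q\<in>\<Phi> N. \<integral>x. v (q + h) x \<bullet> v (q + h') x \<partial>M) / real (card (\<Phi> N))) \<longlonglongrightarrow> 0"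
  shows "(\<lambda>N. mean_square M (set_average (\<Phi> N) v)) \<longlonglongrightarrow> 0"
proof (rule mean_square_tendsto_0I)
  fix e :: real assume "e > 0"
  have C0: "C \<ge> 0" using C[of 0] mean_square_nonneg[of M "v 0"] by linarith
  \<comment> \<open>The factor 2 anticipates the final bound \<open>2 * a N + 2 * b N\<close>, whose
    limit is 2 * C / m.\<close>
  obtain m where "2 * C / e < real m" using reals_Archimedean2 by blast
  moreover from this have m: "m > 0" using C0 \<open>e > 0\<close> by (cases m) (auto simp: field_simps not_less)
  ultimately have m_e: "2 * (C / real m) < e" using \<open>e > 0\<close> by (simp add: field_simps)
  define w where "w q = set_average {..<m} (\<lambda>i. v (q + of_nat i))" for q
  define a where "a N = mean_square M (\<lambda>x. set_average (\<Phi> N) v x - set_average (\<Phi> N) w x)" for N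
  define c where "c i j N = (\<Sum>q\<in>\<Phi> N. \<integral>x. v (q + of_nat i) x \<bullet> v (q + of_nat j) x \<partial>M) / real (card (\<Phi> N))"
    for i j N
  \<comment> \<open>The diagonal correlations are bounded by \<open>C\<close> but need not converge,
    so \<open>C\<close> is put in their place to obtain an expression with a limit.\<close>
  define b where "b N = (\<Sum>i<m. \<Sum>j<m. if i = j then C else c i j N) / (real m)\<^sup>2" for N
  have w_L2: "w q \<in> L2 M" for q unfolding w_def by (intro L2_set_average v)

  \<comment> \<open>Interchanging the two averages writes the difference as a mean of m shift
    errors, each of which tends to 0.\<close>
  have "a \<longlonglongrightarrow> 0"
  proof (rule real_tendsto_sandwich[where f = "\<lambda>_. 0"])
    let ?s = "\<lambda>N i. mean_square M (\<lambda>x. set_average (\<Phi> N) v x - set_average (\<Phi> N) (\<lambda>q. v (q + of_nat i)) x)"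
    have "(\<lambda>N. (\<Sum>i<m. ?s N i) / real m) \<longlonglongrightarrow> (\<Sum>i<m. 0) / real m"
      using m by (intro tendsto_divide tendsto_sum tendsto_const Folner_average_shift[where C = C] \<Phi> v C) simp
    then show "(\<lambda>N. (\<Sum>i<m. ?s N i) / real m) \<longlonglongrightarrow> 0" by simp
    have "a N \<le> (\<Sum>i<m. ?s N i) / real m" for N
    proof -
      have "set_average (\<Phi> N) w x =
          set_average {..<m} (\<lambda>i. set_average (\<Phi> N) (\<lambda>q. v (q + of_nat i))) x" for x
      proof -
        have "(\<Sum>q\<in>\<Phi> N. \<Sum>i<m. v (q + of_nat i) x) = (\<Sum>i<m. \<Sum>q\<in>\<Phi> N. v (q + of_nat i) x)"
          by (rule sum.swap)
        then show ?thesis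
          by (simp add: set_average_def w_def sum_divide_distrib[symmetric])
      qed
      then have "(\<lambda>x. set_average (\<Phi> N) v x - set_average (\<Phi> N) w x) =
          set_average {..<m} (\<lambda>i x. set_average (\<Phi> N) v x - set_average (\<Phi> N) (\<lambda>q. v (q + of_nat i)) x)"
        using m by (simp add: fun_eq_iff set_average_def[of "{..<m}"] sum_subtractf field_simps)
      then show ?thesis
        unfolding a_def
        using mean_square_set_average_le[of "{..<m}"
            "\<lambda>i x. set_average (\<Phi> N) v x - set_average (\<Phi> N) (\<lambda>q. v (q + of_nat i)) x" M]
        by (simp add: L2_diff L2_set_average v)
    qed
    then show "\<forall>\<^sub>F N in sequentially. a N \<le> (\<Sum>i<m. ?s N i) / real m" by simp
  qed (auto simp: a_def mean_square_nonneg)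

  have w_sq: "mean_square M (w q) =
      (\<Sum>i<m. \<Sum>j<m. \<integral>x. v (q + of_nat i) x \<bullet> v (q + of_nat j) x \<partial>M) / (real m)\<^sup>2" for q
  proof -
    have "mean_square M (w q) = mean_square M (\<lambda>x. \<Sum>i<m. v (q + of_nat i) x) / (real m)\<^sup>2"
      using mean_square_scale[of M "1 / of_nat m" "\<lambda>x. \<Sum>i<m. v (q + of_nat i) x"]
      by (simp add: w_def set_average_def[abs_def] norm_divide power_divide)
    also have "mean_square M (\<lambda>x. \<Sum>i<m. v (q + of_nat i) x) =
        (\<integral>x. (\<Sum>i<m. \<Sum>j<m. v (q + of_nat i) x \<bullet> v (q + of_nat j) x) \<partial>M)"
      by (simp add: mean_square_def power2_norm_eq_inner inner_sum_left inner_sum_right inner_commute)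
    also have "\<dots> = (\<Sum>i<m. \<Sum>j<m. \<integral>x. v (q + of_nat i) x \<bullet> v (q + of_nat j) x \<partial>M)"
      by (simp add: integrable_inner_L2 v)
    finally show ?thesis .
  qed
  have diag: "c i i N \<le> C" for i N
  proof -
    have "(\<Sum>q\<in>\<Phi> N. \<integral>x. v (q + of_nat i) x \<bullet> v (q + of_nat i) x \<partial>M) \<le> real (card (\<Phi> N)) * C"
      using C by (intro sum_bounded_above) (simp add: mean_square_def power2_norm_eq_inner)
    then show ?thesis
      using Folner_card_pos[OF \<Phi>, of N] by (simp add: c_def field_simps)
  qed
  have w_b: "mean_square M (set_average (\<Phi> N) w) \<le> b N" for N
  proof -
    have "mean_square M (set_average (\<Phi> N) w) \<le> (\<Sum>q\<in>\<Phi> N. mean_square M (w q)) / real (card (\<Phi> N))"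
      by (intro mean_square_set_average_le w_L2)
    also have "(\<Sum>q\<in>\<Phi> N. mean_square M (w q)) =
        (\<Sum>i<m. \<Sum>j<m. \<Sum>q\<in>\<Phi> N. \<integral>x. v (q + of_nat i) x \<bullet> v (q + of_nat j) x \<partial>M) / (real m)\<^sup>2"
      unfolding w_sq sum_divide_distrib[symmetric]
      by (subst sum.swap) (subst sum.swap[of _ "\<Phi> N"], rule refl)
    also have "\<dots> / real (card (\<Phi> N)) = (\<Sum>i<m. \<Sum>j<m. c i j N) / (real m)\<^sup>2"
      by (simp add: c_def sum_divide_distrib[symmetric])
    also have "\<dots> \<le> b N"
      unfolding b_def by (intro divide_right_mono sum_mono) (auto simp: diag)
    finally show ?thesis .
  qed

  have "b \<longlonglongrightarrow> (\<Sum>i<m. \<Sum>j<m. if i = j then C else 0) / (real m)\<^sup>2"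
    unfolding b_def
  proof (intro tendsto_divide tendsto_sum tendsto_const)
    fix i j :: nat
    show "(\<lambda>N. if i = j then C else c i j N) \<longlonglongrightarrow> (if i = j then C else 0)"
      using corr[of "of_nat i" "of_nat j"] by (auto simp: c_def)
  qed (use m in simp)
  \<comment> \<open>Of the m^2 entries only the m diagonal ones remain.\<close>
  also have "(\<Sum>i<m. \<Sum>j<m. if i = j then C else 0) / (real m)\<^sup>2 = C / real m"
    by (simp add: power2_eq_square)
  finally have "(\<lambda>N. 2 * a N + 2 * b N) \<longlonglongrightarrow> 2 * 0 + 2 * (C / real m)"
    using \<open>a \<longlonglongrightarrow> 0\<close> by (intro tendsto_intros)
  then have "\<forall>\<^sub>F N in sequentially. 2 * a N + 2 * b N < e"
    using m_e by (intro order_tendstoD(2)) auto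
  then show "\<forall>\<^sub>F N in sequentially. mean_square M (set_average (\<Phi> N) v) < e"
  proof eventually_elim
    case (elim N)
    have "mean_square M (set_average (\<Phi> N) v) \<le> 2 * a N + 2 * mean_square M (set_average (\<Phi> N) w)"
      unfolding a_def
      using mean_square_add_le[OF L2_diff[OF L2_set_average[of "\<Phi> N" v M] L2_set_average[of "\<Phi> N" w M]]
          L2_set_average[of "\<Phi> N" w M]]
      by (simp add: v w_L2)
    with w_b[of N] elim show ?case by linarith
  qed
qed

section \<open>The mean ergodic theorem along linear polynomials\<close>

lemma (in Q_system) mean_square_cong:
  "(\<And>x. x \<in> X \<Longrightarrow> f x = g x) \<Longrightarrow> mean_square M f = mean_square M g"
  unfolding mean_square_def by (intro Bochner_Integration.integral_cong) (auto simp: space_M)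

text \<open>Induction over the hull: a translate of the function is a shift of the averaging
  variable, which the Folner property absorbs, and midpoints follow from linearity of the
  averages.\<close>

lemma (in Q_system) orbit_hull_average:
  assumes "g \<in> orbit_hull f" and f: "f \<in> L2 M" and "a \<noteq> 0" and \<Phi>: "Folner \<Phi>"
  shows "(\<lambda>N. mean_square M (\<lambda>x. set_average (\<Phi> N) (\<lambda>q x. f (T (b + a * q) x)) x
    - set_average (\<Phi> N) (\<lambda>q x. g (T (b + a * q) x)) x)) \<longlonglongrightarrow> 0"
  using assms(1)
proof induction
  case base
  show ?case by (simp add: mean_square_def)
next
  case (shift g p)
  let ?A = "\<lambda>g N. set_average (\<Phi> N) (\<lambda>q x. g (T (b + a * q) x))"
  have A_L2: "?A g N \<in> L2 M" if "g \<in> L2 M" for g N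
    using that by (intro L2_set_average L2_T)
  have g: "g \<in> L2 M" by (rule orbit_hull_L2[OF shift.hyps f])
  define v where "v q x = g (T (b + a * q) x)" for q x
  have v: "v q \<in> L2 M" "mean_square M (v q) \<le> mean_square M g" for q
    unfolding v_def[abs_def] using L2_T[OF g] mean_square_T[OF g] by auto
  \<comment> \<open>Here \<open>a \<noteq> 0\<close> and the divisibility of the rationals are used:
    b + a (q + p / a) = p + (b + a q). The action law holds only on \<open>X\<close>, so the
    averages are compared through \<open>mean_square_cong\<close>.\<close>
  have "v (q + p / a) x = g (T p (T (b + a * q) x))" if "x \<in> X" for q x
    using action_add[OF that, of p "b + a * q"] \<open>a \<noteq> 0\<close> by (simp add: v_def algebra_simps)
  then have "mean_square M (\<lambda>x. ?A g N x - ?A (\<lambda>x. g (T p x)) N x) =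
      mean_square M (\<lambda>x. set_average (\<Phi> N) v x - set_average (\<Phi> N) (\<lambda>q. v (q + p / a)) x)" for N
    by (intro mean_square_cong) (simp add: set_average_def v_def)
  with Folner_average_shift[OF \<Phi> v]
  have 1: "(\<lambda>N. mean_square M (\<lambda>x. ?A g N x - ?A (\<lambda>x. g (T p x)) N x)) \<longlonglongrightarrow> 0"
    by simp
  show ?case
  proof (rule real_tendsto_sandwich[where f = "\<lambda>_. 0"])
    show "(\<lambda>N. 2 * mean_square M (\<lambda>x. ?A f N x - ?A g N x)
        + 2 * mean_square M (\<lambda>x. ?A g N x - ?A (\<lambda>x. g (T p x)) N x)) \<longlonglongrightarrow> 0"
      using tendsto_add[OF tendsto_mult[OF tendsto_const[of 2] shift.IH] tendsto_mult[OF tendsto_const[of 2] 1]]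
      by simp
    have "mean_square M (\<lambda>x. ?A f N x - ?A (\<lambda>x. g (T p x)) N x) \<le>
        2 * mean_square M (\<lambda>x. ?A f N x - ?A g N x)
        + 2 * mean_square M (\<lambda>x. ?A g N x - ?A (\<lambda>x. g (T p x)) N x)" for N
      using mean_square_add_le[OF L2_diff[OF A_L2[OF f, of N] A_L2[OF g, of N]]
          L2_diff[OF A_L2[OF g, of N] A_L2[OF L2_T[OF g, of p], of N]]] by simp
    then show "\<forall>\<^sub>F N in sequentially. mean_square M (\<lambda>x. ?A f N x - ?A (\<lambda>x. g (T p x)) N x) \<le>
        2 * mean_square M (\<lambda>x. ?A f N x - ?A g N x)
        + 2 * mean_square M (\<lambda>x. ?A g N x - ?A (\<lambda>x. g (T p x)) N x)" by simp
  qed (auto simp: mean_square_nonneg)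
next
  case (midpoint g h)
  let ?A = "\<lambda>g N. set_average (\<Phi> N) (\<lambda>q x. g (T (b + a * q) x))"
  have A_L2: "?A g N \<in> L2 M" if "g \<in> L2 M" for g N
    using that by (intro L2_set_average L2_T)
  have g: "g \<in> L2 M" and h: "h \<in> L2 M"
    using orbit_hull_L2[OF _ f] midpoint.hyps by auto
  let ?u = "\<lambda>N x. ?A f N x - ?A (\<lambda>x. (g x + h x) / 2) N x"
  have u: "?u N = (\<lambda>x. 1 / 2 * ((?A f N x - ?A g N x) + (?A f N x - ?A h N x)))" for N
    by (simp add: fun_eq_iff set_average_def sum_divide_distrib[symmetric] sum.distrib
        add_divide_distrib diff_divide_distrib mult.commute)
  show ?case
  proof (rule real_tendsto_sandwich[where f = "\<lambda>_. 0"])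
    show "(\<lambda>N. 2 * mean_square M (\<lambda>x. ?A f N x - ?A g N x)
        + 2 * mean_square M (\<lambda>x. ?A f N x - ?A h N x)) \<longlonglongrightarrow> 0"
      using tendsto_add[OF tendsto_mult[OF tendsto_const[of 2] midpoint.IH(1)]
          tendsto_mult[OF tendsto_const[of 2] midpoint.IH(2)]]
      by simp
    have "mean_square M (?u N) \<le> 2 * mean_square M (\<lambda>x. ?A f N x - ?A g N x)
        + 2 * mean_square M (\<lambda>x. ?A f N x - ?A h N x)" for N
    proof -
      let ?s = "\<lambda>x. (?A f N x - ?A g N x) + (?A f N x - ?A h N x)"
      have "mean_square M (?u N) = (cmod (1 / 2))\<^sup>2 * mean_square M ?s"
        unfolding u by (rule mean_square_scale)
      also have "\<dots> \<le> mean_square M ?s"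
        using mean_square_nonneg[of M ?s] by (intro mult_left_le_one_le) (auto simp: power2_eq_square)
      also have "\<dots> \<le> 2 * mean_square M (\<lambda>x. ?A f N x - ?A g N x)
        + 2 * mean_square M (\<lambda>x. ?A f N x - ?A h N x)"
        by (intro mean_square_add_le L2_diff A_L2 f g h)
      finally show ?thesis .
    qed
    then show "\<forall>\<^sub>F N in sequentially. mean_square M (?u N) \<le> 2 * mean_square M (\<lambda>x. ?A f N x - ?A g N x)
        + 2 * mean_square M (\<lambda>x. ?A f N x - ?A h N x)" by simp
  qed (auto simp: mean_square_nonneg)
qed

lemma (in ergodic_Q_system) mean_ergodic_linear:
  assumes f: "f \<in> L2 M" and zero: "(\<integral>x. f x \<partial>M) = 0" and a: "a \<noteq> 0" and \<Phi>: "Folner \<Phi>"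
  shows "(\<lambda>N. mean_square M (set_average (\<Phi> N) (\<lambda>q x. f (T (b + a * q) x)))) \<longlonglongrightarrow> 0"
proof (rule mean_square_tendsto_0I)
  fix e :: real assume "e > 0"
  let ?A = "\<lambda>g N. set_average (\<Phi> N) (\<lambda>q x. g (T (b + a * q) x))"
  \<comment> \<open>Averaging does not increase the bound on \<open>g\<close>, so the total is below
    2 * (e / 4) + 2 * (e / 4) = e.\<close>
  obtain g where g: "g \<in> orbit_hull f" and g_e: "mean_square M g < e / 4"
    using orbit_hull_small[OF f zero, of "e / 4"] \<open>e > 0\<close> by auto
  have g_L2: "g \<in> L2 M" by (rule orbit_hull_L2[OF g f])
  have "\<forall>\<^sub>F N in sequentially. mean_square M (\<lambda>x. ?A f N x - ?A g N x) < e / 4"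
    using orbit_hull_average[OF g f a \<Phi>] \<open>e > 0\<close> by (intro order_tendstoD(2)) auto
  then show "\<forall>\<^sub>F N in sequentially. mean_square M (?A f N) < e"
  proof eventually_elim
    case (elim N)
    have "mean_square M (?A g N) \<le> (\<Sum>q\<in>\<Phi> N. mean_square M (\<lambda>x. g (T (b + a * q) x))) / real (card (\<Phi> N))"
      by (intro mean_square_set_average_le L2_T g_L2)
    also have "\<dots> = mean_square M g"
      using Folner_card_pos[OF \<Phi>, of N] by (simp add: mean_square_T g_L2)
    finally have "mean_square M (?A g N) < e / 4" using g_e by simp
    moreover have "mean_square M (?A f N) \<le>
        2 * mean_square M (\<lambda>x. ?A f N x - ?A g N x) + 2 * mean_square M (?A g N)"
      using mean_square_add_le[of "\<lambda>x. ?A f N x - ?A g N x" M "?A g N"]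
      by (simp add: L2_diff L2_set_average L2_T f g_L2)
    ultimately show ?case using elim by simp
  qed
qed

section \<open>Polynomial averages\<close>

text \<open>The leading coefficients cancel, so the degree drops. If \<open>R\<close> were a
  constant c, then P (x + s) = P x + c for s = h - h', so \<open>P\<close> would agree with an
  affine polynomial at the infinitely many points n s and have degree at most 1.\<close>

lemma degree_poly_difference:
  fixes P :: "'a :: field_char_0 poly"
  assumes "degree P \<ge> 2" "h \<noteq> h'"
  defines "R \<equiv> pcompose P [:h, 1:] - pcompose P [:h', 1:]"
  shows "degree R < degree P" "degree R > 0"
proof -
  have deg: "degree (pcompose P [:h, 1:]) = degree P" for h
    by (simp add: degree_pcompose)
  have "lead_coeff (pcompose P [:h, 1:]) = lead_coeff P" for h
    by (subst lead_coeff_comp) auto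
  then have lead: "coeff (pcompose P [:h, 1:]) (degree P) = lead_coeff P" for h
    by (simp add: deg)
  show "degree R < degree P"
  proof (rule degree_lessI)
    show "R \<noteq> 0 \<or> degree P > 0" using assms(1) by simp
    show "\<forall>k\<ge>degree P. coeff R k = 0"
    proof (intro allI impI)
      fix k assume "degree P \<le> k"
      then show "coeff R k = 0"
        by (cases "k = degree P") (auto simp: R_def lead coeff_eq_0 deg)
    qed
  qed
  show "degree R > 0"
  proof (rule ccontr)
    assume "\<not> degree R > 0"
    then obtain c where c: "R = [:c:]" by (auto elim: degree_eq_zeroE)
    define s where "s = h - h'"
    have s: "s \<noteq> 0" using assms(2) by (simp add: s_def)
    have step: "poly P (x + s) = poly P x + c" for x
    proof -
      have "poly R (x - h') = c" by (simp add: c)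
      then show ?thesis by (simp add: R_def poly_pcompose s_def algebra_simps)
    qed
    have mult: "poly P (of_nat n * s) = poly P 0 + of_nat n * c" for n
    proof (induction n)
      case (Suc n)
      then show ?case using step[of "of_nat n * s"] by (simp add: algebra_simps)
    qed simp
    define L where "L = [:poly P 0, c / s:]"
    have "P - L = 0"
    proof (rule ccontr)
      assume "P - L \<noteq> 0"
      then have "finite {x. poly (P - L) x = 0}" by (rule poly_roots_finite)
      moreover have "range (\<lambda>n. of_nat n * s) \<subseteq> {x. poly (P - L) x = 0}"
        using s by (auto simp: mult L_def)
      ultimately have "finite (range (\<lambda>n::nat. of_nat n * s))" by (rule finite_subset[rotated])
      moreover have "inj (\<lambda>n::nat. of_nat n * s)" using s by (auto simp: inj_on_def)
      ultimately show False using finite_imageD by fastforce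
    qed
    then have "P = L" by simp
    moreover have "degree L \<le> 1" by (simp add: L_def)
    ultimately have "degree P \<le> 1" by (rule ssubst)
    with assms(1) show False by simp
  qed
qed

lemma (in ergodic_Q_system) polynomial_mean_ergodic:
  assumes f: "f \<in> L2 M" and zero: "(\<integral>x. f x \<partial>M) = 0" and \<Phi>: "Folner \<Phi>"
  shows "degree P > 0 \<Longrightarrow>
    (\<lambda>N. mean_square M (set_average (\<Phi> N) (\<lambda>q x. f (T (poly P q) x)))) \<longlonglongrightarrow> 0"
proof (induction "degree P" arbitrary: P rule: less_induct)
  case less
  show ?case
  proof (cases "degree P = 1")
    case True
    then obtain b a where P: "P = [:b, a:]" and "a \<noteq> 0" by (rule degree1_coeffs)
    then show ?thesis using mean_ergodic_linear[OF f zero \<open>a \<noteq> 0\<close> \<Phi>, of b] by (simp add: mult.commute)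
  next
    case False
    with less.prems have deg: "degree P \<ge> 2" by simp
    define v where "v q x = f (T (poly P q) x)" for q x
    have v: "v q \<in> L2 M" "mean_square M (v q) \<le> mean_square M f" for q
      unfolding v_def[abs_def] using L2_T[OF f] mean_square_T[OF f] by auto
    have "(\<lambda>N. mean_square M (set_average (\<Phi> N) v)) \<longlonglongrightarrow> 0"
    proof (rule van_der_Corput[OF \<Phi> v])
      fix h h' :: rat assume "h \<noteq> h'"
      define R where "R = pcompose P [:h, 1:] - pcompose P [:h', 1:]"
      define A where "A N = set_average (\<Phi> N) (\<lambda>q x. f (T (poly R q) x))" for N
      have A_L2: "A N \<in> L2 M" for N unfolding A_def by (intro L2_set_average L2_T f)
      have A_lim: "(\<lambda>N. mean_square M (A N)) \<longlonglongrightarrow> 0"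
        unfolding A_def R_def by (intro less.hyps degree_poly_difference deg \<open>h \<noteq> h'\<close>)
      \<comment> \<open>Invariance of the measure under \<open>T (poly P (q + h'))\<close> removes
        the common translation.\<close>
      have corr: "(\<integral>x. v (q + h) x \<bullet> v (q + h') x \<partial>M) = (\<integral>x. f (T (poly R q) x) \<bullet> f x \<partial>M)" for q
      proof -
        let ?p = "poly P (q + h')"
        have "poly R q + ?p = poly P (q + h)" by (simp add: R_def poly_pcompose add.commute)
        then have "(\<integral>x. v (q + h) x \<bullet> v (q + h') x \<partial>M) = (\<integral>x. f (T (poly R q) (T ?p x)) \<bullet> f (T ?p x) \<partial>M)"
          by (intro Bochner_Integration.integral_cong)
            (auto simp: v_def space_M action_add[symmetric])
        also have "\<dots> = (\<integral>x. f (T (poly R q) x) \<bullet> f x \<partial>M)"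
          using integral_T[of "\<lambda>x. f (T (poly R q) x) \<bullet> f x" ?p]
            integrable_inner_L2[OF L2_T[OF f] f] by auto
        finally show ?thesis .
      qed
      \<comment> \<open>The second factor no longer depends on \<open>q\<close>, so the sum moves
        inside: the mean correlation is the inner product of \<open>f\<close> with an average along
        \<open>R\<close>, to which the induction hypothesis and Cauchy-Schwarz apply.\<close>
      have eq: "(\<Sum>q\<in>\<Phi> N. \<integral>x. v (q + h) x \<bullet> v (q + h') x \<partial>M) / real (card (\<Phi> N)) =
          (\<integral>x. A N x \<bullet> f x \<partial>M)" for N
      proof -
        have "A N x \<bullet> f x = (\<Sum>q\<in>\<Phi> N. f (T (poly R q) x) \<bullet> f x) / real (card (\<Phi> N))" for x
        proof -
          have "A N x = (1 / real (card (\<Phi> N))) *\<^sub>R (\<Sum>q\<in>\<Phi> N. f (T (poly R q) x))"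
            by (simp add: A_def set_average_def scaleR_conv_of_real)
          then show ?thesis by (simp add: inner_sum_left)
        qed
        then show ?thesis
          by (simp add: corr integrable_inner_L2 L2_T f)
      qed
      have "(\<lambda>N. (\<integral>x. A N x \<bullet> f x \<partial>M)\<^sup>2) \<longlonglongrightarrow> 0"
      proof (rule real_tendsto_sandwich[where f = "\<lambda>_. 0"])
        show "(\<lambda>N. mean_square M (A N) * mean_square M f) \<longlonglongrightarrow> 0"
          using tendsto_mult[OF A_lim tendsto_const[of "mean_square M f"]] by simp
        show "\<forall>\<^sub>F N in sequentially. (\<integral>x. A N x \<bullet> f x \<partial>M)\<^sup>2 \<le> mean_square M (A N) * mean_square M f"
          by (intro always_eventually allI Cauchy_Schwarz_L2 A_L2 f)
      qed auto
      from tendsto_real_sqrt[OF this]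
      show "(\<lambda>N. (\<Sum>q\<in>\<Phi> N. \<integral>x. v (q + h) x \<bullet> v (q + h') x \<partial>M) / real (card (\<Phi> N))) \<longlonglongrightarrow> 0"
        unfolding eq by (simp add: tendsto_rabs_zero_iff)
    qed
    then show ?thesis by (simp add: v_def[abs_def])
  qed
qed

theorem theorem6p2:
  fixes X :: "'a :: metric_space set" and M :: "'a measure" and T :: "rat \<Rightarrow> 'a \<Rightarrow> 'a"
    and P :: "rat poly" and f :: "'a \<Rightarrow> complex"
  assumes "ergodic_Q_system X M T"
    and "degree P > 0"
    and "f \<in> L2 M"
  shows "UC_lim_L2 M (\<lambda>q. f \<circ> T (poly P q)) (\<lambda>x. \<integral>y. f y \<partial>M)"
  unfolding UC_lim_L2_def
proof (intro allI impI)
  interpret ergodic_Q_system X M T by fact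
  note f = \<open>f \<in> L2 M\<close>
  fix \<Phi> assume \<Phi>: "Folner \<Phi>"
  define c where "c = (\<integral>y. f y \<partial>M)"
  let ?u = "\<lambda>N x. 1 / of_nat (card (\<Phi> N)) * (\<Sum>q\<in>\<Phi> N. (f \<circ> T (poly P q)) x)"
  define g where "g x = f x - c" for x
  have g: "g \<in> L2 M" unfolding g_def[abs_def] by (intro L2_diff f L2_const)
  have "(\<integral>x. g x \<partial>M) = 0"
    by (simp add: g_def integrable_L2[OF f] prob_space c_def)
  from polynomial_mean_ergodic[OF g this \<Phi> \<open>degree P > 0\<close>]
  have lim: "(\<lambda>N. sqrt (mean_square M (set_average (\<Phi> N) (\<lambda>q x. g (T (poly P q) x))))) \<longlonglongrightarrow> 0"
    using tendsto_real_sqrt by fastforce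
  \<comment> \<open>The average of the constant \<open>c\<close> is \<open>c\<close> because
    \<open>\<Phi> N\<close> is finite and nonempty.\<close>
  have "set_average (\<Phi> N) (\<lambda>q x. g (T (poly P q) x)) = (\<lambda>x. ?u N x - c)" for N
    using Folner_card_pos[OF \<Phi>, of N]
    by (simp add: fun_eq_iff set_average_def g_def sum_subtractf diff_divide_distrib)
  with lim have "(\<lambda>N. L2_norm M (\<lambda>x. ?u N x - c)) \<longlonglongrightarrow> 0"
    by (simp add: L2_norm_eq_sqrt)
  moreover have "?u N \<in> L2 M" for N
    unfolding comp_def by (intro L2_scale L2_sum L2_T f)
  ultimately show "L2_tendsto M ?u (\<lambda>x. \<integral>y. f y \<partial>M)"
    using L2_const by (simp add: L2_tendsto_def c_def)
qed

end
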